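(* For every $\varphi\in\mathsf{Form}_\Box$: if $\mathcal{CMM}\models\varphi$, then $\mathcal{BM}+\mathsf{BEM}\models\varphi$.
   Context: The modal language $\mathsf{Form}_\Box$ is generated by $\top$, $\bot$, propositional variables $p\in\mathsf{Prop}$, $\wedge,\vee,\to$ and $\Box$. A concrete mixed model is $\langle W,R,\{\mathcal M_w\}_{w\in W}\rangle$ with $W\ne\emptyset$, $R\subseteq W\times W$, each $\mathcal M_w=\langle W_w,\leq_w,V_w\rangle$ a rooted intuitionistic Kripke model (partial order $\leq_w$ with least element $\overline w$, valuation $V_w:W_w\to\mathcal P(\mathsf{Prop})$ monotone in $\leq_w$), the $W_w$ pairwise disjoint; $\leq,V$ denote the unions. Forcing at a point $x\in\bigcup_wW_w$: $x\Vdash p$ iff $p\in V(x)$; $x\nVdash\bot$; $\wedge,\vee$ pointwise; $x\Vdash\varphi\to\psi$ iff every $y\geq x$ forcing $\varphi$ forces $\psi$; $x\Vdash\Box\varphi$ iff $\overline v\Vdash\varphi$ for all $v\in W$ with $wRv$, where $w$ is the unique element with $\overline w\leq x$. $\mathcal{CMM}\models\varphi$ means $\varphi$ is forced at every point of every concrete mixed model. A birelational model is $\langle U,\leq,R,V\rangle$ with $U\ne\emptyset$, $\leq$ a partial order, $R\subseteq U\times U$ such that $x\leq y$ and $yRz$ imply $xRz$, and $V:U\to\mathcal P(\mathsf{Prop})$ monotone in $\leq$; forcing uses the same propositional clauses and $x\Vdash\Box\varphi$ iff $y\Vdash\varphi$ for all $y$ with $xRy$. The condition $\mathsf{BEM}$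 is: $x\leq y$ and $xRz$ imply $yRz$. $\mathcal{BM}+\mathsf{BEM}\models\varphi$ means $\varphi$ is forced at every world of every birelational model satisfying $\mathsf{BEM}$. *)

theory Defs
  imports "HOL-Library.Infinite_Typeclass"
begin

datatype 'p form =
    Top
  | Bot
  | Var 'p
  | And "'p form" "'p form"
  | Or "'p form" "'p form"
  | Imp "'p form" "'p form"
  | Box "'p form"

record ('x, 'p) ikm =
  ipoints :: "'x set"
  iord :: "('x \<times> 'x) set"
  ival :: "'x \<Rightarrow> 'p set"

definition is_ikm :: "('x, 'p) ikm \<Rightarrow> bool" where
  "is_ikm M \<longleftrightarrow>
     ipoints M \<noteq> {} \<and>
     partial_order_on (ipoints M) (iord M) \<and>
     (\<forall>x y. (x, y) \<in> iord M \<longrightarrow> ival M x \<subseteq> ival M y)"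

definition is_least :: "('x, 'p) ikm \<Rightarrow> 'x \<Rightarrow> bool" where
  "is_least M r \<longleftrightarrow> r \<in> ipoints M \<and> (\<forall>x \<in> ipoints M. (r, x) \<in> iord M)"

definition rooted_ikm :: "('x, 'p) ikm \<Rightarrow> bool" where
  "rooted_ikm M \<longleftrightarrow> is_ikm M \<and> (\<exists>r. is_least M r)"

definition root_pt :: "('x, 'p) ikm \<Rightarrow> 'x" where
  "root_pt M = (THE r. is_least M r)"

record ('w, 'x, 'p) cmm =
  cworlds :: "'w set"
  crel :: "('w \<times> 'w) set"
  cmodel :: "'w \<Rightarrow> ('x, 'p) ikm"

definition is_cmm :: "('w, 'x, 'p) cmm \<Rightarrow> bool" where
  "is_cmm K \<longleftrightarrow>
     cworlds K \<noteq> {} \<and>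
     crel K \<subseteq> cworlds K \<times> cworlds K \<and>
     (\<forall>w \<in> cworlds K. rooted_ikm (cmodel K w)) \<and>
     (\<forall>w \<in> cworlds K. \<forall>v \<in> cworlds K. w \<noteq> v \<longrightarrow>
        ipoints (cmodel K w) \<inter> ipoints (cmodel K v) = {})"

definition cpoints :: "('w, 'x, 'p) cmm \<Rightarrow> 'x set" where
  "cpoints K = (\<Union>w \<in> cworlds K. ipoints (cmodel K w))"

definition cord :: "('w, 'x, 'p) cmm \<Rightarrow> ('x \<times> 'x) set" where
  "cord K = (\<Union>w \<in> cworlds K. iord (cmodel K w))"

text \<open>By disjointness the union has exactly one member for every point of the model.\<close>

definition cval :: "('w, 'x, 'p) cmm \<Rightarrow> 'x \<Rightarrow> 'p set" where
  "cval K x = (\<Union>w \<in> {w \<in> cworlds K. x \<in> ipoints (cmodel K w)}. ival (cmodel K w) x)"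

definition croot :: "('w, 'x, 'p) cmm \<Rightarrow> 'w \<Rightarrow> 'x" where
  "croot K w = root_pt (cmodel K w)"

definition cworld_of :: "('w, 'x, 'p) cmm \<Rightarrow> 'x \<Rightarrow> 'w" where
  "cworld_of K x = (THE w. w \<in> cworlds K \<and> (croot K w, x) \<in> cord K)"

primrec cforces :: "('w, 'x, 'p) cmm \<Rightarrow> 'x \<Rightarrow> 'p form \<Rightarrow> bool" where
  "cforces K x Top \<longleftrightarrow> True"
| "cforces K x Bot \<longleftrightarrow> False"
| "cforces K x (Var p) \<longleftrightarrow> p \<in> cval K x"
| "cforces K x (And \<phi> \<psi>) \<longleftrightarrow> cforces K x \<phi> \<and> cforces K x \<psi>"
| "cforces K x (Or \<phi> \<psi>) \<longleftrightarrow> cforces K x \<phi> \<or> cforces K x \<psi>"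
| "cforces K x (Imp \<phi> \<psi>) \<longleftrightarrow>
     (\<forall>y. (x, y) \<in> cord K \<longrightarrow> cforces K y \<phi> \<longrightarrow> cforces K y \<psi>)"
| "cforces K x (Box \<phi>) \<longleftrightarrow>
     (\<forall>v \<in> cworlds K. (cworld_of K x, v) \<in> crel K \<longrightarrow> cforces K (croot K v) \<phi>)"

record ('u, 'p) birel =
  bworlds :: "'u set"
  bord :: "('u \<times> 'u) set"
  brel :: "('u \<times> 'u) set"
  bval :: "'u \<Rightarrow> 'p set"

definition is_birel :: "('u, 'p) birel \<Rightarrow> bool" where
  "is_birel B \<longleftrightarrow>
     bworlds B \<noteq> {} \<and>
     partial_order_on (bworlds B) (bord B) \<and>
     brel B \<subseteq> bworlds B \<times> bworlds B \<and>
     (\<forall>x y z. (x, y) \<in> bord B \<longrightarrow> (y, z) \<in> brel B \<longrightarrow> (x, z) \<in> brel B) \<and>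
     (\<forall>x y. (x, y) \<in> bord B \<longrightarrow> bval B x \<subseteq> bval B y)"

definition BEM :: "('u, 'p) birel \<Rightarrow> bool" where
  "BEM B \<longleftrightarrow> (\<forall>x y z. (x, y) \<in> bord B \<longrightarrow> (x, z) \<in> brel B \<longrightarrow> (y, z) \<in> brel B)"

primrec bforces :: "('u, 'p) birel \<Rightarrow> 'u \<Rightarrow> 'p form \<Rightarrow> bool" where
  "bforces B x Top \<longleftrightarrow> True"
| "bforces B x Bot \<longleftrightarrow> False"
| "bforces B x (Var p) \<longleftrightarrow> p \<in> bval B x"
| "bforces B x (And \<phi> \<psi>) \<longleftrightarrow> bforces B x \<phi> \<and> bforces B x \<psi>"
| "bforces B x (Or \<phi> \<psi>) \<longleftrightarrow> bforces B x \<phi> \<or> bforces B x \<psi>"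
| "bforces B x (Imp \<phi> \<psi>) \<longleftrightarrow>
     (\<forall>y. (x, y) \<in> bord B \<longrightarrow> bforces B y \<phi> \<longrightarrow> bforces B y \<psi>)"
| "bforces B x (Box \<phi>) \<longleftrightarrow> (\<forall>y. (x, y) \<in> brel B \<longrightarrow> bforces B y \<phi>)"

text \<open>
  HOL cannot quantify over types inside a formula, so validity in a class of models refers to a
  universe type from which all carrier sets (arbitrary nonempty subsets) are drawn. Both notions
  of validity use one and the same universe, which is infinite so that, as in set theory, there
  is room for pairs of its elements and hence for pairwise disjoint copies of its subsets.
\<close>

definition CMM_valid :: "'a::infinite itself \<Rightarrow> 'p form \<Rightarrow> bool" where
  "CMM_valid T \<phi> \<longleftrightarrow>
     (\<forall>K :: ('a, 'a, 'p) cmm. is_cmm K \<longrightarrow> (\<forall>x \<in> cpoints K. cforces K x \<phi>))"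

definition BM_BEM_valid :: "'a::infinite itself \<Rightarrow> 'p form \<Rightarrow> bool" where
  "BM_BEM_valid T \<phi> \<longleftrightarrow>
     (\<forall>B :: ('a, 'p) birel. is_birel B \<and> BEM B \<longrightarrow> (\<forall>x \<in> bworlds B. bforces B x \<phi>))"

end

theory Submission
  imports Defs
begin

text \<open>
  Given a birelational model, let the local model at a world \<open>w\<close> be a copy of the upward closure
  of \<open>w\<close>, whose points are the pairs \<open>(w, x)\<close> with \<open>w \<le> x\<close>; the root is \<open>(w, w)\<close>. Forcing at
  \<open>(w, x)\<close> agrees with forcing at \<open>x\<close>: for the propositional connectives because the copies are
  upward closed, and for \<open>\<box>\<close> because the frame condition and \<open>BEM\<close> together say that \<open>w\<close> and
  \<open>x\<close> have the same \<open>R\<close>-successors. Since the universe is infinite, pairs can be coded in it.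
\<close>

definition unravel :: "('a \<times> 'a \<Rightarrow> 'a) \<Rightarrow> ('a, 'p) birel \<Rightarrow> ('a, 'a, 'p) cmm" where
  "unravel e B = \<lparr>cworlds = bworlds B, crel = brel B,
     cmodel = (\<lambda>w. \<lparr>ipoints = {e (w, x) | x. (w, x) \<in> bord B},
                    iord = {(e (w, x), e (w, y)) | x y. (w, x) \<in> bord B \<and> (x, y) \<in> bord B},
                    ival = (\<lambda>z. bval B (snd (inv e z)))\<rparr>)\<rparr>"

text \<open>Infinitude of the universe enters here: an infinite set is equipotent with its
  square.\<close>

lemma inj_pairing_exists:
  obtains e :: "'a::infinite \<times> 'a \<Rightarrow> 'a" where "inj e"
proof -
  obtain e :: "'a \<times> 'a \<Rightarrow> 'a" where "bij_betw e (UNIV \<times> UNIV) UNIV"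
    using card_of_Times_same_infinite[OF infinite_UNIV, folded card_of_ordIso] by blast
  then show thesis
    by (intro that[of e]) (simp add: bij_betw_def)
qed

context
  fixes B :: "('a, 'p) birel" and e :: "'a \<times> 'a \<Rightarrow> 'a"
  assumes birel: "is_birel B" and inj: "inj e"
begin

lemma bord_refl: "x \<in> bworlds B \<Longrightarrow> (x, x) \<in> bord B"
  using birel unfolding is_birel_def partial_order_on_def preorder_on_def refl_on_def by blast

lemma bord_trans: "(x, y) \<in> bord B \<Longrightarrow> (y, z) \<in> bord B \<Longrightarrow> (x, z) \<in> bord B"
  using birel unfolding is_birel_def partial_order_on_def preorder_on_def
  by (blast dest: transD)

lemma bord_antisym: "(x, y) \<in> bord B \<Longrightarrow> (y, x) \<in> bord B \<Longrightarrow> x = y"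
  using birel unfolding is_birel_def partial_order_on_def by (blast dest: antisymD)

lemma bord_worlds:
  assumes "(x, y) \<in> bord B"
  shows "x \<in> bworlds B" and "y \<in> bworlds B"
  using assms birel unfolding is_birel_def partial_order_on_def preorder_on_def refl_on_def
  by auto

lemma e_eq_iff [simp]: "e p = e q \<longleftrightarrow> p = q"
  using inj by (simp add: inj_eq)

text \<open>A least point \<open>e (w, x)\<close> lies below \<open>e (w, w)\<close>, so x \<le> w
  as well as w \<le> x. The equivalence yields both existence of a root and the uniqueness that
  \<open>THE\<close> in \<open>root_pt\<close> requires.\<close>

lemma is_least_unravel:
  assumes "w \<in> bworlds B"
  shows "is_least (cmodel (unravel e B) w) r \<longleftrightarrow> r = e (w, w)"
proof
  assume "is_least (cmodel (unravel e B) w) r"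
  then obtain x where x: "r = e (w, x)" "(w, x) \<in> bord B"
    and "(r, e (w, w)) \<in> iord (cmodel (unravel e B) w)"
    using bord_refl[OF assms] unfolding is_least_def unravel_def by auto
  then have "(x, w) \<in> bord B"
    by (auto simp: unravel_def)
  with x show "r = e (w, w)"
    using bord_antisym by blast
next
  assume "r = e (w, w)"
  then show "is_least (cmodel (unravel e B) w) r"
    using bord_refl[OF assms] by (auto simp: is_least_def unravel_def)
qed

lemma croot_unravel: "w \<in> bworlds B \<Longrightarrow> croot (unravel e B) w = e (w, w)"
  unfolding croot_def root_pt_def by (rule the_equality) (simp_all add: is_least_unravel)

lemma is_ikm_unravel:
  assumes "w \<in> bworlds B"
  shows "is_ikm (cmodel (unravel e B) w)"
proof -
  let ?M = "cmodel (unravel e B) w"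
  \<comment> \<open>Transitivity keeps the upper end of a pair inside the upward closure of
    \<open>w\<close>.\<close>
  have "iord ?M \<subseteq> ipoints ?M \<times> ipoints ?M"
    unfolding unravel_def by simp (blast intro: bord_trans)
  moreover have "refl_on (ipoints ?M) (iord ?M)"
    using bord_refl bord_worlds(2) by (fastforce simp: unravel_def refl_on_def)
  moreover have "trans (iord ?M)"
  proof (rule transI)
    fix x y z
    assume "(x, y) \<in> iord ?M" and "(y, z) \<in> iord ?M"
    then obtain a b c where "x = e (w, a)" "z = e (w, c)"
      and "(w, a) \<in> bord B" "(a, b) \<in> bord B" "(b, c) \<in> bord B"
      by (auto simp: unravel_def)
    then show "(x, z) \<in> iord ?M"
      using bord_trans[of a b c] by (simp add: unravel_def)
  qed
  moreover have "antisym (iord ?M)"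
    by (rule antisymI) (use bord_antisym in \<open>auto simp: unravel_def\<close>)
  ultimately have "partial_order_on (ipoints ?M) (iord ?M)"
    unfolding partial_order_on_def preorder_on_def by blast
  moreover have "ival ?M x \<subseteq> ival ?M y" if "(x, y) \<in> iord ?M" for x y
  proof -
    obtain a b where "x = e (w, a)" "y = e (w, b)" "(a, b) \<in> bord B"
      using \<open>(x, y) \<in> iord ?M\<close> by (auto simp: unravel_def)
    then show ?thesis
      using birel inj unfolding is_birel_def by (simp add: unravel_def)
  qed
  moreover have "ipoints ?M \<noteq> {}"
    using bord_refl[OF assms] by (auto simp: unravel_def)
  ultimately show ?thesis
    unfolding is_ikm_def by blast
qed

text \<open>Distinct copies are disjoint because injectivity of \<open>e\<close> lets the tag
  \<open>w\<close> be read off a point.\<close>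

lemma is_cmm_unravel: "is_cmm (unravel e B)"
proof -
  have "rooted_ikm (cmodel (unravel e B) w)" if "w \<in> bworlds B" for w
    using that is_ikm_unravel is_least_unravel unfolding rooted_ikm_def by blast
  then show ?thesis
    using birel unfolding is_cmm_def is_birel_def by (auto simp: unravel_def)
qed

lemma cord_unravel_iff:
  assumes "(w, x) \<in> bord B"
  shows "(e (w, x), z) \<in> cord (unravel e B) \<longleftrightarrow> (\<exists>y. z = e (w, y) \<and> (x, y) \<in> bord B)"
  using assms bord_worlds(1)[OF assms] unfolding cord_def unravel_def by auto

text \<open>The tag leaves a single local model contributing to the union, and \<open>inv e\<close>
  recovers \<open>x\<close> there.\<close>

lemma cval_unravel:
  assumes "(w, x) \<in> bord B"
  shows "cval (unravel e B) (e (w, x)) = bval B x"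
  using assms bord_worlds(1)[OF assms] inj unfolding cval_def unravel_def by auto

lemma cworld_of_unravel:
  assumes "(w, x) \<in> bord B"
  shows "cworld_of (unravel e B) (e (w, x)) = w"
proof -
  \<comment> \<open>The order never leaves a copy, so a root below \<open>e (w, x)\<close> must
    carry the tag \<open>w\<close>. In this form the definite description collapses to
    \<open>w\<close>.\<close>
  have "v \<in> bworlds B \<and> (e (v, v), e (w, x)) \<in> cord (unravel e B) \<longleftrightarrow> v = w" for v
    using assms cord_unravel_iff[OF bord_refl, of v] bord_worlds(1)[OF assms] by auto
  moreover have "cworlds (unravel e B) = bworlds B"
    by (simp add: unravel_def)
  ultimately have "v \<in> cworlds (unravel e B) \<and>
      (croot (unravel e B) v, e (w, x)) \<in> cord (unravel e B) \<longleftrightarrow> v = w" for v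
    using croot_unravel by metis
  then show ?thesis
    unfolding cworld_of_def by simp
qed

text \<open>Left to right is \<open>BEM\<close>, right to left the frame condition in
  \<open>is_birel\<close>. Forcing of \<box> at \<open>e (w, x)\<close> inspects the successors of
  \<open>w\<close>, whereas \<open>bforces\<close> inspects those of \<open>x\<close>.\<close>

lemma brel_cong_bord:
  assumes "BEM B" and "(w, x) \<in> bord B"
  shows "(w, v) \<in> brel B \<longleftrightarrow> (x, v) \<in> brel B"
  using assms birel unfolding BEM_def is_birel_def by blast

lemma cforces_unravel_iff:
  assumes "BEM B" and "(w, x) \<in> bord B"
  shows "cforces (unravel e B) (e (w, x)) \<phi> \<longleftrightarrow> bforces B x \<phi>"
  using assms(2)
\<comment> \<open>Both coordinates vary: implication moves \<open>x\<close> upwards within a copy,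
  while \<box> jumps to another copy.\<close>
proof (induction \<phi> arbitrary: w x)
  case (Var p)
  then show ?case by (simp add: cval_unravel)
next
  case (Imp \<phi> \<psi>)
  have "cforces (unravel e B) (e (w, y)) \<chi> \<longleftrightarrow> bforces B y \<chi>"
    if "(x, y) \<in> bord B" and "\<chi> = \<phi> \<or> \<chi> = \<psi>" for y \<chi>
    using Imp.IH bord_trans[OF Imp.prems that(1)] that(2) by blast
  then show ?case
    using cord_unravel_iff[OF Imp.prems] by auto
next
  case (Box \<phi>)
  \<comment> \<open>The induction hypothesis is used at the diagonal pair \<open>(v, v)\<close>, the
    root of the copy at \<open>v\<close>.\<close>
  have "cforces (unravel e B) (croot (unravel e B) v) \<phi> \<longleftrightarrow> bforces B v \<phi>"
    if "v \<in> bworlds B" for v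
    using Box.IH[OF bord_refl[OF that]] croot_unravel[OF that] by simp
  moreover have "cworlds (unravel e B) = bworlds B" and "crel (unravel e B) = brel B"
    by (simp_all add: unravel_def)
  \<comment> \<open>This reconciles the unbounded quantifier in \<open>bforces\<close> with the one
    over \<open>cworlds\<close> in \<open>cforces\<close>.\<close>
  moreover have "v \<in> bworlds B" if "(x, v) \<in> brel B" for v
    using that birel unfolding is_birel_def by blast
  ultimately show ?case
    using cworld_of_unravel[OF Box.prems] brel_cong_bord[OF assms(1) Box.prems] by auto
qed simp_all

end

theorem theorem3p3p2:
  fixes \<phi> :: "'p form"
  assumes "CMM_valid TYPE('a::infinite) \<phi>"
  shows "BM_BEM_valid TYPE('a) \<phi>"
  unfolding BM_BEM_valid_def
proof (intro allI impI ballI)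
  fix B :: "('a, 'p) birel" and x
  assume B: "is_birel B \<and> BEM B" and x: "x \<in> bworlds B"
  obtain e :: "'a \<times> 'a \<Rightarrow> 'a" where e: "inj e"
    by (rule inj_pairing_exists)
  have refl: "(x, x) \<in> bord B"
    using B e x bord_refl[of B e x] by simp
  \<comment> \<open>The world \<open>x\<close> is tested at the root of its own copy.\<close>
  then have "e (x, x) \<in> cpoints (unravel e B)"
    using x by (auto simp: cpoints_def unravel_def)
  then have "cforces (unravel e B) (e (x, x)) \<phi>"
    using assms is_cmm_unravel[of B e] B e unfolding CMM_valid_def by blast
  then show "bforces B x \<phi>"
    using cforces_unravel_iff[of B e] B e refl by blast
qed

end
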